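(* Let $G'$ and $G''$ be simple connected graphs on $[n]$ whose Laplacian simplices $\mathcal{P}_{G'}$ and $\mathcal{P}_{G''}$ are reflexive. Let $B$ be the bridge graph on $[2n]$ obtained by taking $G'$ on vertices $1,\dots,n$, a copy of $G''$ on vertices $n+1,\dots,2n$ (vertex $j$ of $G''$ becoming $n+j$), and adding the edge $\{n,2n\}$. Let $L$ be the Laplacian of $B$ and $L(2n)$ be $L$ with its $2n$-th column deleted, so $\mathcal{P}_B=\mathrm{conv}(\text{rows of }L(2n))$. Then the set of lattice points in the fundamental parallelepiped of $\mathcal{P}_B$ equals \[ \left\{(\lambda',\lambda'')\cdot[L(2n)\mid\mathbb{1}],\ \left((\lambda',\lambda'')+\tfrac{1}{2n}\mathbb{1}\right)\cdot[L(2n)\mid\mathbb{1}]\;\middle|\;\lambda'\in\Lambda(\mathcal{P}_{G'}),\ \lambda''\in\Lambda(\mathcal{P}_{G''}),\ \lambda'_n=\lambda''_n\right\}. \]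
   Context: The Laplacian matrix $L$ of a simple graph on $[m]$ has $L_{ii}=\deg(i)$, $L_{ij}=-1$ if $\{i,j\}$ is an edge and $0$ otherwise; the Laplacian simplex $\mathcal{P}_G$ is the convex hull in $\mathbb{R}^{m-1}$ of the rows $\mathbf{v}_1,\dots,\mathbf{v}_m$ (in order) of $L$ with its $m$-th column deleted. A lattice polytope is reflexive if it contains the origin in its interior and its dual is a lattice polytope. For a lattice simplex with ordered vertices $\mathbf{v}_1,\dots,\mathbf{v}_{d+1}$, the fundamental parallelepiped is $\{\sum_i\lambda_i(\mathbf{v}_i,1)\mid0\le\lambda_i<1\}$ and $\Lambda(\mathcal{P})$ is the set of $\lambda\in[0,1)^{d+1}$ with $\sum_i\lambda_i(\mathbf{v}_i,1)\in\mathbb{Z}^{d+1}$. $[M\mid\mathbb{1}]$ is $M$ with a column of ones appended. *)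

theory Defs
  imports Complex_Main "Jordan_Normal_Form.Matrix"
begin

text \<open>
  Vectors of \<open>\<real>\<^sup>d\<close>, with \<open>d\<close> a natural number, are the elements of \<open>carrier_vec d\<close>.  A graph on
  \<open>[m] = {1..m}\<close> is given by its set of edges, each of which is a two-element set of vertices.
  Positions in vectors and matrices count from \<open>0\<close>, so vertex \<open>i\<close> owns position \<open>i - 1\<close>.
\<close>

subsection \<open>Graphs and their Laplacians\<close>

definition simple_graph_on :: "nat \<Rightarrow> nat set set \<Rightarrow> bool" where
  "simple_graph_on m E \<longleftrightarrow> E \<subseteq> {{i, j} | i j. i \<in> {1..m} \<and> j \<in> {1..m} \<and> i \<noteq> j}"

definition connected_graph_on :: "nat \<Rightarrow> nat set set \<Rightarrow> bool" where
  "connected_graph_on m E \<longleftrightarrow> (\<forall>i\<in>{1..m}. \<forall>j\<in>{1..m}. (i, j) \<in> {(u, v). {u, v} \<in> E}\<^sup>*)"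

definition degree :: "nat set set \<Rightarrow> nat \<Rightarrow> nat" where
  "degree E i = card {e \<in> E. i \<in> e}"

definition laplacian :: "nat \<Rightarrow> nat set set \<Rightarrow> real mat" where
  "laplacian m E = mat m m (\<lambda>(i, j).
     if i = j then real (degree E (Suc i))
     else if {Suc i, Suc j} \<in> E then - 1 else 0)"

definition delete_last_col :: "'a mat \<Rightarrow> 'a mat" where
  "delete_last_col A = mat (dim_row A) (dim_col A - 1) (\<lambda>(i, j). A $$ (i, j))"

text \<open>The matrix \<open>L(m)\<close>, whose rows are the ordered vertices of the Laplacian simplex.\<close>

definition reduced_laplacian :: "nat \<Rightarrow> nat set set \<Rightarrow> real mat" where
  "reduced_laplacian m E = delete_last_col (laplacian m E)"

definition bridge_graph :: "nat \<Rightarrow> nat set set \<Rightarrow> nat set set \<Rightarrow> nat set set" where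
  "bridge_graph n E' E'' = E' \<union> (\<lambda>e. (\<lambda>j. n + j) ` e) ` E'' \<union> {{n, 2 * n}}"

subsection \<open>Polytopes\<close>

definition int_vecs :: "nat \<Rightarrow> real vec set" where
  "int_vecs d = {x \<in> carrier_vec d. \<forall>i<d. x $ i \<in> \<int>}"

text \<open>The type \<open>real vec\<close> contains vectors of all lengths and is not a \<open>real_vector\<close>, so
  convexity, convex hulls and interiors are taken relative to \<open>carrier_vec d\<close>.\<close>

definition convex_vecs :: "nat \<Rightarrow> real vec set \<Rightarrow> bool" where
  "convex_vecs d C \<longleftrightarrow> C \<subseteq> carrier_vec d \<and>
     (\<forall>x\<in>C. \<forall>y\<in>C. \<forall>u\<ge>0. \<forall>v\<ge>0. u + v = 1 \<longrightarrow> u \<cdot>\<^sub>v x + v \<cdot>\<^sub>v y \<in> C)"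

definition conv :: "nat \<Rightarrow> real vec set \<Rightarrow> real vec set" where
  "conv d S = convex_vecs d hull S"

definition interior_vecs :: "nat \<Rightarrow> real vec set \<Rightarrow> real vec set" where
  "interior_vecs d P = {x \<in> carrier_vec d. \<exists>\<epsilon>>0. \<forall>y\<in>carrier_vec d.
     sqrt ((y - x) \<bullet> (y - x)) < \<epsilon> \<longrightarrow> y \<in> P}"

definition lattice_polytope :: "nat \<Rightarrow> real vec set \<Rightarrow> bool" where
  "lattice_polytope d P \<longleftrightarrow> (\<exists>V. finite V \<and> V \<subseteq> int_vecs d \<and> P = conv d V)"

definition dual_polytope :: "nat \<Rightarrow> real vec set \<Rightarrow> real vec set" where
  "dual_polytope d P = {u \<in> carrier_vec d. \<forall>x\<in>P. u \<bullet> x \<le> 1}"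

definition reflexive :: "nat \<Rightarrow> real vec set \<Rightarrow> bool" where
  "reflexive d P \<longleftrightarrow> lattice_polytope d P \<and> 0\<^sub>v d \<in> interior_vecs d P
     \<and> lattice_polytope d (dual_polytope d P)"

definition laplacian_simplex :: "nat \<Rightarrow> nat set set \<Rightarrow> real vec set" where
  "laplacian_simplex m E = conv (m - 1) (set (rows (reduced_laplacian m E)))"

subsection \<open>Fundamental parallelepipeds\<close>

text \<open>A simplex with ordered vertices is represented by the matrix \<open>M\<close> having these vertices as
  its rows.\<close>

definition ones_vec :: "nat \<Rightarrow> real vec" where
  "ones_vec d = vec d (\<lambda>_. 1)"

definition append_ones :: "real mat \<Rightarrow> real mat" where
  "append_ones M = mat (dim_row M) (dim_col M + 1) (\<lambda>(i, j). if j < dim_col M then M $$ (i, j) else 1)"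

definition row_mult :: "real vec \<Rightarrow> real mat \<Rightarrow> real vec" where
  "row_mult l A = transpose_mat A *\<^sub>v l"

definition unit_cube :: "nat \<Rightarrow> real vec set" where
  "unit_cube d = {l \<in> carrier_vec d. \<forall>i<d. 0 \<le> l $ i \<and> l $ i < 1}"

definition fund_parallelepiped :: "real mat \<Rightarrow> real vec set" where
  "fund_parallelepiped M = (\<lambda>l. row_mult l (append_ones M)) ` unit_cube (dim_row M)"

definition Lambda :: "real mat \<Rightarrow> real vec set" where
  "Lambda M = {l \<in> unit_cube (dim_row M). row_mult l (append_ones M) \<in> int_vecs (dim_col M + 1)}"

end

theory Submission
  imports "Jordan_Normal_Form.Determinant" Defs
begin

text \<open>
  A reflexive Laplacian simplex with vertices \<open>v\<^sub>1, \<dots>, v\<^sub>n\<close> has, for every \<open>i\<close>, an integral facet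
  normal \<open>u\<close> with \<open>u \<bullet> v\<^sub>k = 1\<close> for \<open>k \<noteq> i\<close>.  The vertices add up to 0, so \<open>u \<bullet> v\<^sub>i = 1 - n\<close>, and
  pairing \<open>u\<close> with an integral combination \<open>\<Sum>\<^sub>k \<lambda>\<^sub>k v\<^sub>k\<close> yields \<open>n\<lambda>\<^sub>i \<equiv> \<Sum>\<^sub>k \<lambda>\<^sub>k\<close> modulo 1.  On the bridge
  graph, summing the columns belonging to one half isolates the bridge and forces \<open>\<lambda>\<^sub>n = \<lambda>\<^sub>2\<^sub>n\<close>,
  which makes the conditions on the two halves independent apart from that on the coordinate sum.
\<close>

section \<open>Linear functionals on convex hulls and interiors\<close>

lemma int_vecs_carrier: "x \<in> int_vecs d \<Longrightarrow> x \<in> carrier_vec d"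
  by (simp add: int_vecs_def)

lemma convex_vecs_halfspaces:
  fixes w :: "real vec"
  assumes w: "w \<in> carrier_vec d"
  shows "convex_vecs d {x \<in> carrier_vec d. w \<bullet> x \<le> c}"
    and "convex_vecs d {x \<in> carrier_vec d. w \<bullet> x < c}"
proof -
  have lin: "w \<bullet> (u \<cdot>\<^sub>v x + v \<cdot>\<^sub>v y) = u * (w \<bullet> x) + v * (w \<bullet> y)"
    if "x \<in> carrier_vec d" "y \<in> carrier_vec d" for u v x y
    using that w by (simp add: scalar_prod_add_distrib[of _ d])
  show "convex_vecs d {x \<in> carrier_vec d. w \<bullet> x \<le> c}"
    unfolding convex_vecs_def using convex_bound_le[of _ c] by (auto simp: lin)
  show "convex_vecs d {x \<in> carrier_vec d. w \<bullet> x < c}"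
    unfolding convex_vecs_def using convex_bound_lt[of _ c] by (auto simp: lin)
qed

lemma conv_le:
  fixes w :: "real vec"
  assumes "w \<in> carrier_vec d" "S \<subseteq> carrier_vec d" "\<forall>x\<in>S. w \<bullet> x \<le> c" "x \<in> conv d S"
  shows "x \<in> carrier_vec d" "w \<bullet> x \<le> c"
proof -
  have "conv d S \<subseteq> {x \<in> carrier_vec d. w \<bullet> x \<le> c}"
    unfolding conv_def by (rule hull_minimal) (use assms convex_vecs_halfspaces in auto)
  with assms(4) show "x \<in> carrier_vec d" "w \<bullet> x \<le> c" by auto
qed

text \<open>If every point of \<open>S\<close> were strictly below \<open>c\<close>, the open
  half-space would be a convex set containing \<open>S\<close>, hence the hull. This stands in for a
  maximum over the vertices.\<close>

lemma conv_attains: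
  fixes w :: "real vec"
  assumes "w \<in> carrier_vec d" "S \<subseteq> carrier_vec d" "x \<in> conv d S" "c \<le> w \<bullet> x"
  obtains v where "v \<in> S" "c \<le> w \<bullet> v"
proof -
  have "\<exists>v\<in>S. c \<le> w \<bullet> v"
  proof (rule ccontr)
    assume "\<not> ?thesis"
    then have "conv d S \<subseteq> {x \<in> carrier_vec d. w \<bullet> x < c}"
      unfolding conv_def by (intro hull_minimal) (use assms convex_vecs_halfspaces in auto)
    with assms(3,4) show False by auto
  qed
  with that show ?thesis by blast
qed

text \<open>A small positive multiple \<open>t\<close> of \<open>u\<close> still lies in
  \<open>P\<close>, and \<open>u\<close> takes the value \<open>t * (u \<bullet> u)\<close>
  there.\<close>

lemma interior_zero_imp_functional_zero:
  fixes u :: "real vec"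
  assumes int: "0\<^sub>v d \<in> interior_vecs d P" and u: "u \<in> carrier_vec d"
    and le: "\<And>x. x \<in> P \<Longrightarrow> u \<bullet> x \<le> 0"
  shows "u = 0\<^sub>v d"
proof -
  from int obtain e where e: "e > 0"
    and ball: "\<And>y. y \<in> carrier_vec d \<Longrightarrow> sqrt ((y - 0\<^sub>v d) \<bullet> (y - 0\<^sub>v d)) < e \<Longrightarrow> y \<in> P"
    unfolding interior_vecs_def by auto
  have uu: "u \<bullet> u = (\<Sum>i<d. (u $ i)\<^sup>2)"
    using u by (simp add: scalar_prod_def power2_eq_square atLeast0LessThan)
  then have nn: "u \<bullet> u \<ge> 0" by (simp add: sum_nonneg)
  define s where "s = sqrt (u \<bullet> u)"
  \<comment> \<open>The summand 1 keeps the denominator positive when \<open>u\<close> is zero; the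
    length \<open>t * s\<close> stays below \<open>e\<close>.\<close>
  define t where "t = e / (2 * (s + 1))"
  have s: "s \<ge> 0" unfolding s_def using nn by simp
  have t: "t > 0" unfolding t_def using e s by simp
  have "sqrt ((t \<cdot>\<^sub>v u) \<bullet> (t \<cdot>\<^sub>v u)) = t * s"
    using t u by (simp add: s_def real_sqrt_mult)
  also have "\<dots> < e"
  proof -
    have "e * s < e * (2 * (s + 1))" using e s by simp
    then show ?thesis unfolding t_def using s by (simp add: field_simps)
  qed
  finally have "sqrt ((t \<cdot>\<^sub>v u) \<bullet> (t \<cdot>\<^sub>v u)) < e" .
  moreover have "t \<cdot>\<^sub>v u - 0\<^sub>v d = t \<cdot>\<^sub>v u" using u by auto
  ultimately have "t \<cdot>\<^sub>v u \<in> P" using ball[of "t \<cdot>\<^sub>v u"] u by simp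
  from le[OF this] have "t * (u \<bullet> u) \<le> 0" using u by simp
  with t nn have "u \<bullet> u = 0" by (simp add: mult_le_0_iff)
  then have "\<forall>i<d. u $ i = 0" unfolding uu by (simp add: sum_nonneg_eq_0_iff)
  then show ?thesis using u by auto
qed

lemma append_ones_carrier: "M \<in> carrier_mat n k \<Longrightarrow> append_ones M \<in> carrier_mat n (k + 1)"
  by (auto simp: append_ones_def)

lemma append_ones_mult_vec:
  assumes M: "M \<in> carrier_mat n k" and w: "w \<in> carrier_vec (k + 1)" and i: "i < n"
  shows "(append_ones M *\<^sub>v w) $ i = row M i \<bullet> vec_first w k + w $ k"
proof -
  have "(append_ones M *\<^sub>v w) $ i = (\<Sum>j<Suc k. append_ones M $$ (i, j) * w $ j)"
    using M w i by (simp add: append_ones_def scalar_prod_def atLeast0LessThan)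
  then show ?thesis
    using M w i by (simp add: append_ones_def scalar_prod_def vec_first_def atLeast0LessThan)
qed

subsection \<open>Facet normals of a reflexive simplex with barycentre 0\<close>

text \<open>The functional is read off a solution of a linear system with matrix
  \<open>append_ones M\<close>: the last unknown is a common constant added to the pairings with all
  rows.\<close>

lemma simplex_opposite_functional:
  fixes M :: "real mat"
  assumes M: "M \<in> carrier_mat n (n - 1)" and i: "i < n"
    and sum0: "\<And>u. u \<in> carrier_vec (n - 1) \<Longrightarrow> (\<Sum>k<n. row M k \<bullet> u) = 0"
    and int: "0\<^sub>v (n - 1) \<in> interior_vecs (n - 1) (conv (n - 1) (set (rows M)))"
  obtains u where "u \<in> carrier_vec (n - 1)"
    "\<And>k. k < n \<Longrightarrow> row M k \<bullet> u = (if k = i then 1 - real n else 1)"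
proof -
  let ?d = "n - 1" and ?A = "append_ones M"
  have n: "?d + 1 = n" using i by simp
  have A: "?A \<in> carrier_mat n n" using append_ones_carrier[OF M] n by simp
  have rows_carrier: "set (rows M) \<subseteq> carrier_vec ?d" using M by (auto simp: rows_def)
  have eq: "(?A *\<^sub>v w) $ k = row M k \<bullet> vec_first w ?d + w $ ?d"
    if "w \<in> carrier_vec n" "k < n" for w k
    using append_ones_mult_vec[OF M, of w k] that n by simp
  have total: "(\<Sum>k<n. (?A *\<^sub>v w) $ k) = real n * w $ ?d" if "w \<in> carrier_vec n" for w
  proof -
    have "(\<Sum>k<n. (?A *\<^sub>v w) $ k) = (\<Sum>k<n. row M k \<bullet> vec_first w ?d + w $ ?d)"
      using eq[OF that] by simp
    then show ?thesis by (simp add: sum.distrib sum0)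
  qed
  \<comment> \<open>The rows of \<open>M\<close> add up to 0, so a kernel vector has last entry 0.
    Its other entries then give a functional vanishing on the whole simplex, which is zero because
    the origin is interior.\<close>
  have "det ?A \<noteq> 0"
  proof
    assume "det ?A = 0"
    then obtain w where w: "w \<in> carrier_vec n" "w \<noteq> 0\<^sub>v n" "?A *\<^sub>v w = 0\<^sub>v n"
      using det_0_iff_vec_prod_zero[OF A] by auto
    let ?u = "vec_first w ?d"
    have last: "w $ ?d = 0" using total[OF w(1)] w(3) i by simp
    have row0: "row M k \<bullet> ?u = 0" if "k < n" for k
      using eq[OF w(1) that] w(3) last that by simp
    have "?u = 0\<^sub>v ?d"
    proof (rule interior_zero_imp_functional_zero[OF int])
      fix x assume "x \<in> conv ?d (set (rows M))"
      moreover have "\<forall>x\<in>set (rows M). ?u \<bullet> x \<le> 0"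
      proof
        fix x assume "x \<in> set (rows M)"
        then obtain k where "k < n" "x = row M k" using M by (auto simp: rows_def)
        then show "?u \<bullet> x \<le> 0"
          using row0[of k] comm_scalar_prod[of ?u ?d x] rows_carrier \<open>x \<in> set (rows M)\<close> by auto
      qed
      ultimately show "?u \<bullet> x \<le> 0" by (intro conv_le(2)[OF _ rows_carrier]) auto
    qed simp
    moreover have "w $ j = ?u $ j" if "j < ?d" for j using that by (simp add: vec_first_def)
    ultimately have "w $ j = 0" if "j < n" for j
      using last that by (cases "j = ?d") (auto simp: less_Suc_eq)
    then show False using w(1,2) by auto
  qed
  then have "?A \<in> Units (ring_mat TYPE(real) n ())" by (rule det_non_zero_imp_unit[OF A])
  then obtain C where C: "C \<in> carrier_mat n n" "?A * C = 1\<^sub>m n"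
    by (auto simp: Units_def ring_mat_simps)
  \<comment> \<open>The entries add up to \<open>- n\<close>, which forces the last unknown to be
    -1; moving it to the right turns 0 and \<open>- n\<close> into 1 and
    \<open>1 - n\<close>.\<close>
  define e where "e = (- real n) \<cdot>\<^sub>v unit_vec n i"
  define w where "w = C *\<^sub>v e"
  have e: "e \<in> carrier_vec n" by (simp add: e_def)
  then have w: "w \<in> carrier_vec n" using C by (simp add: w_def)
  have Aw: "?A *\<^sub>v w = e"
    using A C e unfolding w_def by (simp flip: assoc_mult_mat_vec[of ?A n n C n e])
  have e_ix: "e $ k = (if k = i then - real n else 0)" if "k < n" for k
    using that i by (simp add: e_def)
  have "real n * w $ ?d = (\<Sum>k<n. e $ k)" using total[OF w] Aw by simp
  also have "\<dots> = (\<Sum>k<n. if k = i then - real n else 0)" by (rule sum.cong) (auto simp: e_ix)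
  also have "\<dots> = - real n" using i by simp
  finally have "real n * w $ ?d = real n * - 1" by simp
  then have last: "w $ ?d = - 1" using i unfolding mult_cancel_left by simp
  show ?thesis
  proof (rule that[of "vec_first w ?d"])
    show "row M k \<bullet> vec_first w ?d = (if k = i then 1 - real n else 1)" if "k < n" for k
      using eq[OF w that] Aw e_ix[OF that] last by (auto split: if_splits)
  qed simp
qed

text \<open>These normals are the vertices of the dual simplex. The witness is taken from the
  lattice points \<open>V\<close> spanning the dual and shown to have the same pairings as
  \<open>u0\<close>, so integrality comes for free.\<close>

lemma reflexive_simplex_facet_normal:
  fixes M :: "real mat"
  assumes M: "M \<in> carrier_mat n (n - 1)" and i: "i < n"
    and sum0: "\<And>u. u \<in> carrier_vec (n - 1) \<Longrightarrow> (\<Sum>k<n. row M k \<bullet> u) = 0"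
    and refl: "reflexive (n - 1) (conv (n - 1) (set (rows M)))"
  obtains u where "u \<in> int_vecs (n - 1)"
    "\<And>k. k < n \<Longrightarrow> row M k \<bullet> u = (if k = i then 1 - real n else 1)"
proof -
  let ?d = "n - 1"
  let ?P = "conv ?d (set (rows M))"
  have rows_carrier: "set (rows M) \<subseteq> carrier_vec ?d" using M by (auto simp: rows_def)
  have row_carrier: "row M k \<in> carrier_vec ?d" for k
    by (rule carrier_vecI) (simp add: row_def carrier_matD(2)[OF M])
  have neg: "(- row M i) \<bullet> x = - (row M i \<bullet> x)" if "x \<in> carrier_vec ?d" for x
    using that row_carrier[of i] by (simp only: scalar_prod_uminus_left carrier_vecD)
  obtain u0 where u0: "u0 \<in> carrier_vec ?d"
    and u0_row: "\<And>k. k < n \<Longrightarrow> row M k \<bullet> u0 = (if k = i then 1 - real n else 1)"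
    using simplex_opposite_functional[OF M i sum0] refl unfolding reflexive_def by blast
  obtain V where V: "V \<subseteq> int_vecs ?d" and dual: "dual_polytope ?d ?P = conv ?d V"
    using refl unfolding reflexive_def lattice_polytope_def by blast
  have V_carrier: "V \<subseteq> carrier_vec ?d" using V int_vecs_carrier by blast
  have "\<forall>x\<in>set (rows M). u0 \<bullet> x \<le> 1"
    using M u0 u0_row by (auto simp: rows_def comm_scalar_prod[of u0 ?d])
  then have "u0 \<in> dual_polytope ?d ?P"
    unfolding dual_polytope_def using u0 conv_le(2)[OF u0 rows_carrier] by auto
  \<comment> \<open>Over the dual, \<open>- v\<^sub>i\<close> is at most \<open>n - 1\<close>, with equality only at \<open>u0\<close>; as the maximum
    is attained on \<open>V\<close>, the point \<open>u0\<close> is integral.\<close>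
  moreover have "real n - 1 \<le> (- row M i) \<bullet> u0" using u0_row[OF i] neg[OF u0] by simp
  ultimately obtain u where u: "u \<in> V" and ge: "real n - 1 \<le> (- row M i) \<bullet> u"
    using conv_attains[OF _ V_carrier, of "- row M i" u0] row_carrier[of i] unfolding dual by auto
  have uc: "u \<in> carrier_vec ?d" using u V_carrier by blast
  have "u \<in> dual_polytope ?d ?P" unfolding dual unfolding conv_def by (rule hull_inc[OF u])
  moreover have "row M k \<in> ?P" if "k < n" for k
    unfolding conv_def by (rule hull_inc) (use M that in \<open>auto simp: rows_def\<close>)
  ultimately have le1: "row M k \<bullet> u \<le> 1" if "k < n" for k
    using that comm_scalar_prod[OF row_carrier uc] unfolding dual_polytope_def by auto
  let ?I = "{..<n} - {i}"
  have split: "(\<Sum>k\<in>?I. row M k \<bullet> u) = - (row M i \<bullet> u)"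
    using sum0[OF uc] i by (simp add: sum_diff1)
  have ge': "real n - 1 \<le> - (row M i \<bullet> u)" using ge neg[OF uc] by simp
  \<comment> \<open>All slacks are nonnegative, while their sum is at most 0 by \<open>ge'\<close>;
    hence each vanishes.\<close>
  have "(\<Sum>k\<in>?I. 1 - row M k \<bullet> u) = (real n - 1) + row M i \<bullet> u"
    using i split by (simp add: sum_subtractf of_nat_diff)
  moreover have "(\<Sum>k\<in>?I. 1 - row M k \<bullet> u) \<ge> 0" by (rule sum_nonneg) (use le1 in auto)
  ultimately have zero: "(\<Sum>k\<in>?I. 1 - row M k \<bullet> u) = 0" and rowi: "row M i \<bullet> u = 1 - real n"
    using ge' by auto
  have "\<forall>k\<in>?I. 1 - row M k \<bullet> u = 0"
    using zero by (subst (asm) sum_nonneg_eq_0_iff) (use le1 in auto)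
  with rowi V u show ?thesis by (intro that[of u]) auto
qed

text \<open>The coefficient sum stays in the conclusion as an unknown because on one half of the
  bridge graph it may be a half-integer.\<close>

lemma reflexive_simplex_barycentric:
  fixes M :: "real mat"
  assumes M: "M \<in> carrier_mat n (n - 1)" and i: "i < n"
    and col0: "\<And>j. j < n - 1 \<Longrightarrow> (\<Sum>k<n. M $$ (k, j)) = 0"
    and refl: "reflexive (n - 1) (conv (n - 1) (set (rows M)))"
    and int: "\<And>j. j < n - 1 \<Longrightarrow> (\<Sum>k<n. l k * M $$ (k, j)) \<in> \<int>"
  shows "(\<Sum>k<n. l k) - real n * l i \<in> \<int>"
proof -
  let ?d = "n - 1"
  \<comment> \<open>The same double sum by rows and by columns: \<open>c = 1\<close> shows that the
    vertices add up to 0, \<open>c = l\<close> gives integrality of the pairing.\<close>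
  have swap: "(\<Sum>k<n. c k * (row M k \<bullet> u)) = (\<Sum>j<?d. (\<Sum>k<n. c k * M $$ (k, j)) * u $ j)"
    if "u \<in> carrier_vec ?d" for c u
  proof -
    have "(\<Sum>k<n. c k * (row M k \<bullet> u)) = (\<Sum>k<n. \<Sum>j<?d. c k * M $$ (k, j) * u $ j)"
      using M that by (simp add: scalar_prod_def sum_distrib_left mult.assoc atLeast0LessThan)
    also have "\<dots> = (\<Sum>j<?d. \<Sum>k<n. c k * M $$ (k, j) * u $ j)" by (rule sum.swap)
    finally show ?thesis by (simp add: sum_distrib_right)
  qed
  have sum0: "(\<Sum>k<n. row M k \<bullet> u) = 0" if "u \<in> carrier_vec ?d" for u
    using swap[OF that, of "\<lambda>_. 1"] col0 by simp
  obtain u where u: "u \<in> int_vecs ?d"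
    and row: "\<And>k. k < n \<Longrightarrow> row M k \<bullet> u = (if k = i then 1 - real n else 1)"
    using reflexive_simplex_facet_normal[OF M i sum0 refl] by blast
  have "(\<Sum>k<n. l k * (row M k \<bullet> u)) \<in> \<int>"
    unfolding swap[OF int_vecs_carrier[OF u]]
    by (rule Ints_sum, rule Ints_mult) (use u int in \<open>auto simp: int_vecs_def\<close>)
  also have "(\<Sum>k<n. l k * (row M k \<bullet> u)) = (\<Sum>k<n. l k - (if k = i then real n * l k else 0))"
    by (rule sum.cong) (auto simp: row algebra_simps)
  also have "\<dots> = (\<Sum>k<n. l k) - real n * l i" using i by (simp add: sum_subtractf)
  finally show ?thesis .
qed

subsection \<open>The Laplacian as a difference operator\<close>

text \<open>Entry \<open>j\<close> of the row vector \<open>f\<close> times the full Laplacian, with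
  the degree term spread over the edges at \<open>j\<close>. In this form shift invariance, zero
  total and the splitting along the bridge need no degrees.\<close>

definition graph_laplace :: "nat \<Rightarrow> nat set set \<Rightarrow> (nat \<Rightarrow> real) \<Rightarrow> nat \<Rightarrow> real" where
  "graph_laplace m E f j = (\<Sum>i<m. if {Suc i, Suc j} \<in> E then f j - f i else 0)"

lemma graph_laplace_cong:
  "(\<And>i. i < m \<Longrightarrow> f i = g i) \<Longrightarrow> j < m \<Longrightarrow> graph_laplace m E f j = graph_laplace m E g j"
  unfolding graph_laplace_def by (rule sum.cong) auto

text \<open>This allows \<open>1 / (2n)\<close> to be added to or removed from one half without
  disturbing its Laplacian conditions.\<close>

lemma graph_laplace_shift: "graph_laplace m E (\<lambda>i. f i + c) j = graph_laplace m E f j"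
  unfolding graph_laplace_def by (rule sum.cong) auto

text \<open>Every edge contributes opposite amounts at its two ends.\<close>

lemma sum_graph_laplace: "(\<Sum>j<m. graph_laplace m E f j) = 0"
proof -
  let ?g = "\<lambda>i j. if {Suc i, Suc j} \<in> E then f j - f i else 0"
  have anti: "?g i j = - ?g j i" for i j by (simp add: insert_commute)
  have "(\<Sum>j<m. \<Sum>i<m. ?g i j) = (\<Sum>i<m. \<Sum>j<m. ?g i j)" by (rule sum.swap)
  also have "\<dots> = (\<Sum>i<m. \<Sum>j<m. - ?g j i)" by (subst anti) (rule refl)
  finally show ?thesis by (simp add: graph_laplace_def sum_negf)
qed

lemma simple_graph_on_no_loop: "simple_graph_on m E \<Longrightarrow> {i} \<notin> E"
  unfolding simple_graph_on_def by (auto simp: doubleton_eq_iff)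

lemma simple_graph_on_subset: "simple_graph_on m E \<Longrightarrow> e \<in> E \<Longrightarrow> e \<subseteq> {1..m}"
  unfolding simple_graph_on_def by auto

lemma degree_eq_card_neighbours:
  assumes E: "simple_graph_on m E" and j: "j < m"
  shows "degree E (Suc j) = card {i. i < m \<and> {Suc i, Suc j} \<in> E}"
proof -
  have "{e \<in> E. Suc j \<in> e} = (\<lambda>i. {Suc i, Suc j}) ` {i. i < m \<and> {Suc i, Suc j} \<in> E}"
  proof (intro equalityI subsetI)
    fix e assume "e \<in> {e \<in> E. Suc j \<in> e}"
    then have e: "e \<in> E" "Suc j \<in> e" by auto
    then obtain a b where "e = {a, b}" "a \<in> {1..m}" "b \<in> {1..m}"
      using E unfolding simple_graph_on_def by blast
    with e(2) obtain c where c: "e = {c, Suc j}" "c \<in> {1..m}" by auto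
    then have "Suc (c - 1) = c" "c - 1 < m" by auto
    with c e(1) show "e \<in> (\<lambda>i. {Suc i, Suc j}) ` {i. i < m \<and> {Suc i, Suc j} \<in> E}"
      by (intro image_eqI[of _ _ "c - 1"]) auto
  qed auto
  moreover have "inj_on (\<lambda>i. {Suc i, Suc j}) {i. i < m \<and> {Suc i, Suc j} \<in> E}"
    by (auto simp: inj_on_def doubleton_eq_iff)
  ultimately show ?thesis unfolding degree_def by (simp add: card_image)
qed

text \<open>Write the column as its diagonal part minus the adjacency column; having no loops keeps
  the latter off the diagonal. Counting neighbours then turns the degree into a sum over the same
  index set.\<close>

lemma sum_mult_laplacian:
  assumes E: "simple_graph_on m E" and j: "j < m"
  shows "(\<Sum>i<m. f i * laplacian m E $$ (i, j)) = graph_laplace m E f j"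
proof -
  have deg: "real (degree E (Suc j)) = (\<Sum>i<m. if {Suc i, Suc j} \<in> E then 1 else 0)"
    using sum.inter_filter[of "{..<m}" "\<lambda>_. 1 :: real" "\<lambda>i. {Suc i, Suc j} \<in> E"]
    by (simp add: degree_eq_card_neighbours[OF E j])
  have "(\<Sum>i<m. f i * laplacian m E $$ (i, j)) =
      (\<Sum>i<m. (if i = j then f j * real (degree E (Suc j)) else 0)
        - (if {Suc i, Suc j} \<in> E then f i else 0))"
    by (rule sum.cong) (use j simple_graph_on_no_loop[OF E] in \<open>auto simp: laplacian_def\<close>)
  also have "\<dots> = f j * real (degree E (Suc j)) - (\<Sum>i<m. if {Suc i, Suc j} \<in> E then f i else 0)"
    using j by (simp add: sum_subtractf)
  also have "\<dots> = graph_laplace m E f j"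
    unfolding deg graph_laplace_def sum_distrib_left sum_subtractf[symmetric]
    by (rule sum.cong) auto
  finally show ?thesis .
qed

lemma reduced_laplacian_carrier: "reduced_laplacian m E \<in> carrier_mat m (m - 1)"
  by (simp add: reduced_laplacian_def delete_last_col_def laplacian_def)

lemma sum_mult_reduced_laplacian:
  assumes "simple_graph_on m E" "j < m - 1"
  shows "(\<Sum>i<m. f i * reduced_laplacian m E $$ (i, j)) = graph_laplace m E f j"
proof -
  have "reduced_laplacian m E $$ (i, j) = laplacian m E $$ (i, j)" if "i < m" for i
    using that assms(2) by (simp add: reduced_laplacian_def delete_last_col_def laplacian_def)
  then show ?thesis using sum_mult_laplacian[OF assms(1), of j f] assms(2) by simp
qed

lemma reflexive_laplacian_coordinates:
  assumes E: "simple_graph_on m E" and refl: "reflexive (m - 1) (laplacian_simplex m E)"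
    and int: "\<And>j. j < m \<Longrightarrow> graph_laplace m E f j \<in> \<int>" and i: "i < m"
  shows "(\<Sum>k<m. f k) - real m * f i \<in> \<int>"
proof (rule reflexive_simplex_barycentric[OF reduced_laplacian_carrier i])
  fix j assume j: "j < m - 1"
  \<comment> \<open>Unit coefficients give the sum of the vertices, and constants are
    annihilated.\<close>
  have "(\<Sum>k<m. 1 * reduced_laplacian m E $$ (k, j)) = graph_laplace m E (\<lambda>_. 1) j"
    using sum_mult_reduced_laplacian[OF E j, of "\<lambda>_. 1"] .
  then show "(\<Sum>k<m. reduced_laplacian m E $$ (k, j)) = 0"
    by (simp add: graph_laplace_def cong: if_cong)
  show "(\<Sum>k<m. f k * reduced_laplacian m E $$ (k, j)) \<in> \<int>"
    using sum_mult_reduced_laplacian[OF E j] int[of j] j by simp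
next
  show "reflexive (m - 1) (conv (m - 1) (set (rows (reduced_laplacian m E))))"
    using refl by (simp add: laplacian_simplex_def)
qed

section \<open>Integrality conditions describing \<open>Lambda\<close>\<close>

lemma row_mult_append_ones:
  assumes M: "M \<in> carrier_mat m k" and l: "l \<in> carrier_vec m" and j: "j < k + 1"
  shows "row_mult l (append_ones M) $ j = (\<Sum>i<m. l $ i * (if j < k then M $$ (i, j) else 1))"
proof -
  have "row_mult l (append_ones M) $ j = (\<Sum>i<m. append_ones M $$ (i, j) * l $ i)"
    using M l j by (simp add: row_mult_def append_ones_def scalar_prod_def atLeast0LessThan)
  also have "\<dots> = (\<Sum>i<m. l $ i * (if j < k then M $$ (i, j) else 1))"
    by (rule sum.cong) (use M j in \<open>auto simp: append_ones_def\<close>)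
  finally show ?thesis .
qed

text \<open>The integrality condition at the deleted column \<open>m\<close> is automatic, since the columns of the
  Laplacian add up to 0.\<close>

lemma mem_Lambda_reduced_laplacian:
  assumes E: "simple_graph_on m E" and m: "m \<ge> 1"
  shows "l \<in> Lambda (reduced_laplacian m E) \<longleftrightarrow> l \<in> unit_cube m \<and>
    (\<forall>j<m. graph_laplace m E (($) l) j \<in> \<int>) \<and> (\<Sum>i<m. l $ i) \<in> \<int>"
proof (cases "l \<in> unit_cube m")
  case True
  let ?M = "reduced_laplacian m E"
  note M = reduced_laplacian_carrier[of m E]
  have dims: "dim_row ?M = m" "dim_col ?M + 1 = m" using M m by auto
  have l: "l \<in> carrier_vec m" using True by (simp add: unit_cube_def)
  let ?x = "row_mult l (append_ones ?M)"
  have x: "?x \<in> carrier_vec m"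
    by (rule carrier_vecI) (simp add: row_mult_def append_ones_def dims(2)[simplified])
  \<comment> \<open>The column of ones takes the place of the deleted column, so position
    \<open>m - 1\<close> carries the coordinate sum.\<close>
  have x_ix: "?x $ j = (if j < m - 1 then graph_laplace m E (($) l) j else (\<Sum>i<m. l $ i))"
    if "j < m" for j
    using row_mult_append_ones[OF M l, of j] sum_mult_reduced_laplacian[OF E, of j "($) l"] that m
    by auto
  have split: "(\<forall>j<m. P j) \<longleftrightarrow> (\<forall>j<m - 1. P j) \<and> P (m - 1)" for P
    using m by (cases m) (auto simp: less_Suc_eq)
  have "l \<in> Lambda ?M \<longleftrightarrow> (\<forall>j<m. ?x $ j \<in> \<int>)"
    using True x by (simp add: Lambda_def dims int_vecs_def del: One_nat_def)
  also have "\<dots> \<longleftrightarrow> (\<forall>j<m - 1. graph_laplace m E (($) l) j \<in> \<int>) \<and> (\<Sum>i<m. l $ i) \<in> \<int>"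
    unfolding split using x_ix m by auto
  also have "(\<forall>j<m - 1. graph_laplace m E (($) l) j \<in> \<int>) \<longleftrightarrow>
      (\<forall>j<m. graph_laplace m E (($) l) j \<in> \<int>)"
  proof
    assume int: "\<forall>j<m - 1. graph_laplace m E (($) l) j \<in> \<int>"
    have "{..<m} = insert (m - 1) {..<m - 1}" using m by auto
    then have "graph_laplace m E (($) l) (m - 1) = - (\<Sum>j<m - 1. graph_laplace m E (($) l) j)"
      using sum_graph_laplace[of m E "($) l"] by simp
    then have "graph_laplace m E (($) l) (m - 1) \<in> \<int>" using int by (auto intro!: Ints_sum)
    with int show "\<forall>j<m. graph_laplace m E (($) l) j \<in> \<int>" unfolding split by blast
  qed auto
  finally show ?thesis using True by simp
next
  case False
  then show ?thesis using reduced_laplacian_carrier[of m E] by (auto simp: Lambda_def)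
qed

subsection \<open>The bridge graph\<close>

lemma simple_bridge_graph:
  assumes E': "simple_graph_on n E'" and E'': "simple_graph_on n E''" and n: "n \<ge> 1"
  shows "simple_graph_on (2 * n) (bridge_graph n E' E'')"
  unfolding simple_graph_on_def
proof
  fix e assume "e \<in> bridge_graph n E' E''"
  then consider "e \<in> E'" | d where "d \<in> E''" "e = (\<lambda>j. n + j) ` d" | "e = {n, 2 * n}"
    unfolding bridge_graph_def by blast
  then show "e \<in> {{i, j} | i j. i \<in> {1..2 * n} \<and> j \<in> {1..2 * n} \<and> i \<noteq> j}"
  proof cases
    case 1
    then obtain i j where "e = {i, j}" "i \<in> {1..n}" "j \<in> {1..n}" "i \<noteq> j"
      using E' unfolding simple_graph_on_def by blast
    then show ?thesis by (intro CollectI exI[of _ i] exI[of _ j]) auto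
  next
    case 2
    then obtain i j where "d = {i, j}" "i \<in> {1..n}" "j \<in> {1..n}" "i \<noteq> j"
      using E'' unfolding simple_graph_on_def by blast
    with 2 show ?thesis by (intro CollectI exI[of _ "n + i"] exI[of _ "n + j"]) auto
  next
    case 3
    with n show ?thesis by (intro CollectI exI[of _ n] exI[of _ "2 * n"]) auto
  qed
qed

text \<open>The three edge families are told apart by the range of their vertices. In positions
  counted from 0 the bridge joins \<open>n - 1\<close> and \<open>n + (n - 1)\<close>.\<close>

lemma bridge_graph_edges:
  assumes E': "simple_graph_on n E'" and E'': "simple_graph_on n E''" and ij: "i < n" "j < n"
  shows "{Suc i, Suc j} \<in> bridge_graph n E' E'' \<longleftrightarrow> {Suc i, Suc j} \<in> E'"
    and "{Suc (n + i), Suc (n + j)} \<in> bridge_graph n E' E'' \<longleftrightarrow> {Suc i, Suc j} \<in> E''"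
    and "{Suc (n + i), Suc j} \<in> bridge_graph n E' E'' \<longleftrightarrow> i = n - 1 \<and> j = n - 1"
    and "{Suc i, Suc (n + j)} \<in> bridge_graph n E' E'' \<longleftrightarrow> i = n - 1 \<and> j = n - 1"
proof -
  let ?s = "\<lambda>j. n + j"
  have low: "e \<subseteq> {1..n}" if "e \<in> E'" for e using simple_graph_on_subset[OF E' that] .
  have high: "e \<subseteq> {n + 1..2 * n}" if "e \<in> (`) ?s ` E''" for e
  proof -
    from that obtain d where d: "d \<in> E''" "e = ?s ` d" by blast
    show ?thesis using simple_graph_on_subset[OF E'' d(1)] unfolding d(2) by auto
  qed
  have img: "?s ` {Suc i, Suc j} = {Suc (n + i), Suc (n + j)}" by simp
  have mem: "?s ` e \<in> (`) ?s ` E'' \<longleftrightarrow> e \<in> E''" for e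
    by (rule inj_image_mem_iff) (simp add: inj_def inj_image_eq_iff)
  have bridge: "e \<in> bridge_graph n E' E'' \<longleftrightarrow> e \<in> E' \<or> e \<in> (`) ?s ` E'' \<or> e = {n, 2 * n}" for e
    unfolding bridge_graph_def by blast
  show "{Suc i, Suc j} \<in> bridge_graph n E' E'' \<longleftrightarrow> {Suc i, Suc j} \<in> E'"
    using high[of "{Suc i, Suc j}"] ij unfolding bridge by (auto simp: doubleton_eq_iff)
  show "{Suc (n + i), Suc (n + j)} \<in> bridge_graph n E' E'' \<longleftrightarrow> {Suc i, Suc j} \<in> E''"
    using low[of "{Suc (n + i), Suc (n + j)}"] ij mem[of "{Suc i, Suc j}"]
    unfolding bridge img by (auto simp: doubleton_eq_iff)
  show "{Suc (n + i), Suc j} \<in> bridge_graph n E' E'' \<longleftrightarrow> i = n - 1 \<and> j = n - 1"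
    using low[of "{Suc (n + i), Suc j}"] high[of "{Suc (n + i), Suc j}"] ij
    unfolding bridge by (auto simp: doubleton_eq_iff)
  show "{Suc i, Suc (n + j)} \<in> bridge_graph n E' E'' \<longleftrightarrow> i = n - 1 \<and> j = n - 1"
    using low[of "{Suc i, Suc (n + j)}"] high[of "{Suc i, Suc (n + j)}"] ij
    unfolding bridge by (auto simp: doubleton_eq_iff)
qed

lemma sum_lessThan_double:
  fixes f :: "nat \<Rightarrow> 'a :: comm_monoid_add"
  shows "(\<Sum>i<2 * n. f i) = (\<Sum>i<n. f i) + (\<Sum>i<n. f (n + i))"
proof -
  have "(\<Sum>i<n + m. f i) = (\<Sum>i<n. f i) + (\<Sum>i<m. f (n + i))" for m
    by (induction m) (auto simp: add.assoc)
  from this[of n] show ?thesis by (simp add: mult_2)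
qed

text \<open>Only the two ends of the bridge see the opposite half, and they see it with opposite
  signs.\<close>

lemma graph_laplace_bridge:
  assumes E': "simple_graph_on n E'" and E'': "simple_graph_on n E''" and j: "j < n"
  shows "graph_laplace (2 * n) (bridge_graph n E' E'') f j =
      graph_laplace n E' f j + (if j = n - 1 then f (n - 1) - f (n + (n - 1)) else 0)"
    and "graph_laplace (2 * n) (bridge_graph n E' E'') f (n + j) =
      graph_laplace n E'' (\<lambda>i. f (n + i)) j
        + (if j = n - 1 then f (n + (n - 1)) - f (n - 1) else 0)"
proof -
  note edges = bridge_graph_edges[OF E' E'' _ j]
  have "(\<Sum>i<n. if {Suc (n + i), Suc j} \<in> bridge_graph n E' E'' then f j - f (n + i) else 0)
      = (\<Sum>i<n. if i = n - 1 then (if j = n - 1 then f (n - 1) - f (n + (n - 1)) else 0) else 0)"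
    by (rule sum.cong) (auto simp: edges)
  then show "graph_laplace (2 * n) (bridge_graph n E' E'') f j =
      graph_laplace n E' f j + (if j = n - 1 then f (n - 1) - f (n + (n - 1)) else 0)"
    using j unfolding graph_laplace_def sum_lessThan_double by (simp add: edges)
  have "(\<Sum>i<n. if {Suc i, Suc (n + j)} \<in> bridge_graph n E' E'' then f (n + j) - f i else 0)
      = (\<Sum>i<n. if i = n - 1 then (if j = n - 1 then f (n + (n - 1)) - f (n - 1) else 0) else 0)"
    by (rule sum.cong) (auto simp: edges)
  then show "graph_laplace (2 * n) (bridge_graph n E' E'') f (n + j) =
      graph_laplace n E'' (\<lambda>i. f (n + i)) j
        + (if j = n - 1 then f (n + (n - 1)) - f (n - 1) else 0)"
    using j unfolding graph_laplace_def sum_lessThan_double by (simp add: edges)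
qed

lemma Ints_unit_interval_diff:
  fixes x y :: real
  assumes "x - y \<in> \<int>" "0 \<le> x" "x < 1" "0 \<le> y" "y < 1"
  shows "x = y"
proof -
  obtain k where k: "x - y = of_int k" using assms(1) by (rule Ints_cases)
  then have "\<bar>real_of_int k\<bar> < 1" using assms by linarith
  then have "k = 0" by linarith
  with k show ?thesis by simp
qed

lemma graph_laplace_bridge_Ints:
  assumes E': "simple_graph_on n E'" and E'': "simple_graph_on n E''"
    and unit: "0 \<le> f (n - 1)" "f (n - 1) < 1" "0 \<le> f (n + (n - 1))" "f (n + (n - 1)) < 1"
    and n: "n \<ge> 1"
  shows "(\<forall>j<2 * n. graph_laplace (2 * n) (bridge_graph n E' E'') f j \<in> \<int>) \<longleftrightarrow>
    (\<forall>j<n. graph_laplace n E' f j \<in> \<int>) \<and> (\<forall>j<n. graph_laplace n E'' (\<lambda>i. f (n + i)) j \<in> \<int>) \<and>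
    f (n - 1) = f (n + (n - 1))" (is "?L \<longleftrightarrow> ?R")
proof -
  let ?g = "graph_laplace (2 * n) (bridge_graph n E' E'') f"
  note eq = graph_laplace_bridge[OF E' E'']
  have halves: "?L \<longleftrightarrow> (\<forall>j<n. ?g j \<in> \<int>) \<and> (\<forall>j<n. ?g (n + j) \<in> \<int>)"
  proof safe
    fix j assume 1: "\<forall>j<n. ?g j \<in> \<int>" and 2: "\<forall>j<n. ?g (n + j) \<in> \<int>" and "j < 2 * n"
    then show "?g j \<in> \<int>" using 2[rule_format, of "j - n"] by (cases "j < n") auto
  qed auto
  show ?thesis
  proof
    assume ?L
    \<comment> \<open>Over the first half the internal edges cancel, leaving the difference across
      the bridge: an integer strictly between -1 and 1.\<close>
    have "(\<Sum>j<n. ?g j) = (\<Sum>j<n. graph_laplace n E' f j)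
        + (\<Sum>j<n. if j = n - 1 then f (n - 1) - f (n + (n - 1)) else 0)"
      unfolding sum.distrib[symmetric] by (rule sum.cong) (auto simp: eq)
    then have "(\<Sum>j<n. ?g j) = f (n - 1) - f (n + (n - 1))"
      using n by (simp add: sum_graph_laplace)
    moreover have "(\<Sum>j<n. ?g j) \<in> \<int>" using \<open>?L\<close> by (intro Ints_sum) auto
    ultimately have "f (n - 1) = f (n + (n - 1))"
      by (intro Ints_unit_interval_diff) (use unit in auto)
    with \<open>?L\<close> show ?R unfolding halves by (auto simp: eq)
  next
    assume ?R
    then show ?L unfolding halves by (auto simp: eq)
  qed
qed

section \<open>Lattice points for the bridge graph\<close>

text \<open>By reflexivity \<open>m * l $ i\<close> is an integer below \<open>m\<close>, so
  \<open>l $ i\<close> is at most \<open>1 - 1/m\<close>. The room left keeps shifted vectors inside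
  the unit cube.\<close>

lemma Lambda_reflexive_coordinates:
  assumes E: "simple_graph_on m E" and refl: "reflexive (m - 1) (laplacian_simplex m E)"
    and l: "l \<in> Lambda (reduced_laplacian m E)" and i: "i < m"
  shows "l $ i + 1 / (2 * real m) < 1"
proof -
  have m: "m \<ge> 1" using i by simp
  note l' = l[unfolded mem_Lambda_reduced_laplacian[OF E m]]
  have "(\<Sum>k<m. l $ k) - real m * l $ i \<in> \<int>"
    by (rule reflexive_laplacian_coordinates[OF E refl _ i]) (use l' in auto)
  moreover have "(\<Sum>k<m. l $ k) \<in> \<int>" using l' by blast
  ultimately have "real m * l $ i \<in> \<int>" using Ints_diff by fastforce
  then obtain z where z: "real m * l $ i = of_int z" by (rule Ints_cases)
  have "l $ i < 1" using l' i by (auto simp: unit_cube_def)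
  then have "real m * l $ i < real m * 1" using m by (intro mult_strict_left_mono) auto
  then have "real_of_int z < of_int (int m)" unfolding z by simp
  then have "z \<le> int m - 1" by linarith
  then have "real m * l $ i \<le> real m - 1" unfolding z by linarith
  then show ?thesis using m by (simp add: field_simps)
qed

text \<open>With \<open>s\<close>, \<open>s'\<close> the coordinate sums of the two halves, reflexivity gives \<open>n\<lambda>\<^sub>i \<equiv> s\<close> and
  \<open>n\<lambda>\<^sub>n\<^sub>+\<^sub>i \<equiv> s'\<close> modulo 1; the common last coordinate forces \<open>s \<equiv> s'\<close>, and \<open>s + s'\<close> is an integer.
  Either both are integers, or both are half-integers and \<open>1/(2n)\<close> can be subtracted everywhere.\<close>

lemma Lambda_bridge_graph:
  assumes n: "n \<ge> 1" and E': "simple_graph_on n E'" and E'': "simple_graph_on n E''"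
    and refl': "reflexive (n - 1) (laplacian_simplex n E')"
    and refl'': "reflexive (n - 1) (laplacian_simplex n E'')"
  shows "l \<in> Lambda (reduced_laplacian (2 * n) (bridge_graph n E' E'')) \<longleftrightarrow>
    (\<exists>a b. a \<in> Lambda (reduced_laplacian n E') \<and> b \<in> Lambda (reduced_laplacian n E'') \<and>
      a $ (n - 1) = b $ (n - 1) \<and>
      (l = a @\<^sub>v b \<or> l = (a @\<^sub>v b) + (1 / (2 * real n)) \<cdot>\<^sub>v ones_vec (2 * n)))"
    (is "?L \<longleftrightarrow> ?R")
proof -
  let ?B = "bridge_graph n E' E''" and ?h = "1 / (2 * real n)"
  have n2: "2 * n \<ge> 1" using n by simp
  have h: "real n * ?h = 1 / 2" "?h > 0" using n by auto
  note mem' = mem_Lambda_reduced_laplacian[OF E' n]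
  note mem'' = mem_Lambda_reduced_laplacian[OF E'' n]
  note mem = mem_Lambda_reduced_laplacian[OF simple_bridge_graph[OF E' E'' n] n2]
  have last: "n - 1 < n" using n by simp
  have shifted: "((a @\<^sub>v b) + ?h \<cdot>\<^sub>v ones_vec (2 * n)) $ i = a $ i + ?h"
      "((a @\<^sub>v b) + ?h \<cdot>\<^sub>v ones_vec (2 * n)) $ (n + i) = b $ i + ?h"
    if "a \<in> carrier_vec n" "b \<in> carrier_vec n" "i < n" for a b :: "real vec" and i
    using that by (auto simp: ones_vec_def)
  show ?thesis
  proof
    assume ?L
    then have cube: "l \<in> unit_cube (2 * n)"
      and lap: "\<forall>j<2 * n. graph_laplace (2 * n) ?B (($) l) j \<in> \<int>"
      and sum: "(\<Sum>i<2 * n. l $ i) \<in> \<int>" unfolding mem by auto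
    have lc: "l \<in> carrier_vec (n + n)" and l01: "\<And>i. i < 2 * n \<Longrightarrow> 0 \<le> l $ i \<and> l $ i < 1"
      using cube by (auto simp: unit_cube_def mult_2)
    define s where "s = (\<Sum>i<n. l $ i)"
    define s' where "s' = (\<Sum>i<n. l $ (n + i))"
    have "(\<forall>j<n. graph_laplace n E' (($) l) j \<in> \<int>) \<and>
        (\<forall>j<n. graph_laplace n E'' (\<lambda>i. l $ (n + i)) j \<in> \<int>) \<and> l $ (n - 1) = l $ (n + (n - 1))"
      by (rule iffD1[OF graph_laplace_bridge_Ints[OF E' E'' _ _ _ _ n] lap]) (use l01 n in auto)
    then have lap': "\<And>j. j < n \<Longrightarrow> graph_laplace n E' (($) l) j \<in> \<int>"
      and lap'': "\<And>j. j < n \<Longrightarrow> graph_laplace n E'' (\<lambda>i. l $ (n + i)) j \<in> \<int>"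
      and eq: "l $ (n - 1) = l $ (n + (n - 1))" by auto
    have c': "s - real n * l $ i \<in> \<int>" if "i < n" for i
      unfolding s_def by (rule reflexive_laplacian_coordinates[OF E' refl' lap' that])
    have c'': "s' - real n * l $ (n + i) \<in> \<int>" if "i < n" for i
      unfolding s'_def
      using reflexive_laplacian_coordinates[OF E'' refl'' lap'' that] by simp
    have ss: "s + s' \<in> \<int>" using sum by (simp add: sum_lessThan_double s_def s'_def)
    have "s - s' \<in> \<int>" using Ints_diff[OF c'[OF last] c''[OF last]] eq by simp
    with ss have "(s + s') + (s - s') \<in> \<int>" by (rule Ints_add)
    then obtain z where z: "2 * s = of_int z" by (auto elim: Ints_cases)
    \<comment> \<open>The shift that makes both half sums integral: it changes each of them by
      \<open>n * t\<close>, which is 0 or 1/2 according to the parity of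
      \<open>2 * s\<close>.\<close>
    define t where "t = (if even z then 0 else ?h)"
    have nt: "s - real n * t \<in> \<int>"
    proof (cases "even z")
      case True
      then obtain y where "z = 2 * y" by blast
      with z True show ?thesis by (simp add: t_def)
    next
      case False
      then obtain y where "z = 2 * y + 1" by (rule oddE)
      with z have "s = of_int y + 1 / 2" by simp
      with False h show ?thesis by (simp add: t_def)
    qed
    have nt2: "2 * (real n * t) \<in> \<int>" using h by (simp add: t_def)
    have nt': "s' - real n * t \<in> \<int>"
      using Ints_diff[OF Ints_diff[OF ss nt] nt2] by (simp add: algebra_simps)
    have t0: "t \<ge> 0" using h by (simp add: t_def)
    \<comment> \<open>Subtracting \<open>t\<close> creates no negative entry: for
      \<open>x < t\<close> the difference \<open>n * x - n * t\<close> would lie in [-1/2, 0), which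
      contains no integer.\<close>
    have ge_t: "t \<le> x" if x: "0 \<le> x" "real n * x - real n * t \<in> \<int>" for x
    proof (rule ccontr)
      assume "\<not> t \<le> x"
      then have lt: "x < t" by simp
      obtain k where k: "real n * x - real n * t = of_int k" using x(2) by (rule Ints_cases)
      have "real n * x < real n * t" using lt n by simp
      moreover have "real n * x \<ge> 0" using x(1) by simp
      moreover have "real n * t \<le> 1 / 2" using h by (simp add: t_def)
      ultimately have "- 1 < real_of_int k" "real_of_int k < 0" using k by linarith+
      then have "- 1 < k" "k < 0" by simp_all
      then show False by simp
    qed
    define a where "a = vec n (\<lambda>i. l $ i - t)"
    define b where "b = vec n (\<lambda>i. l $ (n + i) - t)"
    have t_le: "t \<le> l $ i" if "i < n" for i
      using ge_t[of "l $ i"] l01[of i] Ints_diff[OF nt c'[OF that]] that by simp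
    have "0 \<le> l $ i - t \<and> l $ i - t < 1" if "i < n" for i
      using l01[of i] t_le[OF that] t0 that by auto
    then have "a \<in> unit_cube n" by (simp add: unit_cube_def a_def)
    moreover have "graph_laplace n E' (($) a) j \<in> \<int>" if "j < n" for j
    proof -
      have "graph_laplace n E' (($) a) j = graph_laplace n E' (\<lambda>i. l $ i + - t) j"
        by (rule graph_laplace_cong) (use that in \<open>auto simp: a_def\<close>)
      then show ?thesis using lap'[OF that] unfolding graph_laplace_shift by simp
    qed
    moreover have "(\<Sum>i<n. a $ i) \<in> \<int>"
      using nt by (simp add: a_def sum_subtractf s_def)
    ultimately have a: "a \<in> Lambda (reduced_laplacian n E')" unfolding mem' by blast
    have t_le: "t \<le> l $ (n + i)" if "i < n" for i
      using ge_t[of "l $ (n + i)"] l01[of "n + i"] Ints_diff[OF nt' c''[OF that]] that by simp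
    have "0 \<le> l $ (n + i) - t \<and> l $ (n + i) - t < 1" if "i < n" for i
      using l01[of "n + i"] t_le[OF that] t0 that by auto
    then have "b \<in> unit_cube n" by (simp add: unit_cube_def b_def)
    moreover have "graph_laplace n E'' (($) b) j \<in> \<int>" if "j < n" for j
    proof -
      have "graph_laplace n E'' (($) b) j = graph_laplace n E'' (\<lambda>i. l $ (n + i) + - t) j"
        by (rule graph_laplace_cong) (use that in \<open>auto simp: b_def\<close>)
      then show ?thesis using lap''[OF that] unfolding graph_laplace_shift by simp
    qed
    moreover have "(\<Sum>i<n. b $ i) \<in> \<int>"
      using nt' by (simp add: b_def sum_subtractf s'_def)
    ultimately have b: "b \<in> Lambda (reduced_laplacian n E'')" unfolding mem'' by blast
    have ab: "a $ (n - 1) = b $ (n - 1)" using eq n by (simp add: a_def b_def)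
    have "l = (a @\<^sub>v b) + t \<cdot>\<^sub>v ones_vec (2 * n)"
      by (rule eq_vecI) (use lc in \<open>auto simp: a_def b_def ones_vec_def\<close>)
    moreover have "l = a @\<^sub>v b" if "t = 0"
      by (rule eq_vecI) (use lc that in \<open>auto simp: a_def b_def\<close>)
    moreover have "t = 0 \<or> t = ?h" by (simp add: t_def)
    ultimately have "l = a @\<^sub>v b \<or> l = (a @\<^sub>v b) + ?h \<cdot>\<^sub>v ones_vec (2 * n)" by metis
    with a b ab show ?R by blast
  next
    assume ?R
    then obtain a b where a: "a \<in> Lambda (reduced_laplacian n E')"
      and b: "b \<in> Lambda (reduced_laplacian n E'')" and ab: "a $ (n - 1) = b $ (n - 1)"
      and l: "l = a @\<^sub>v b \<or> l = (a @\<^sub>v b) + ?h \<cdot>\<^sub>v ones_vec (2 * n)" by blast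
    note a' = a[unfolded mem'] and b' = b[unfolded mem'']
    have ac: "a \<in> carrier_vec n" and bc: "b \<in> carrier_vec n"
      using a' b' by (auto simp: unit_cube_def)
    have a01: "0 \<le> a $ i" "a $ i < 1" and b01: "0 \<le> b $ i" "b $ i < 1" if "i < n" for i
      using a' b' that by (auto simp: unit_cube_def)
    \<comment> \<open>One parameter covers both forms of \<open>l\<close>.\<close>
    obtain t where t: "t = 0 \<or> t = ?h" and la: "\<And>i. i < n \<Longrightarrow> l $ i = a $ i + t"
      and lb: "\<And>i. i < n \<Longrightarrow> l $ (n + i) = b $ i + t"
    proof (cases "l = a @\<^sub>v b")
      case True
      then show ?thesis using ac bc by (intro that[of 0]) auto
    next
      case False
      then show ?thesis using l shifted[OF ac bc] by (intro that[of ?h]) auto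
    qed
    have lc: "l \<in> carrier_vec (2 * n)"
      by (rule carrier_vecI) (use l ac bc in \<open>auto simp: ones_vec_def\<close>)
    have lt: "a $ i + t < 1" "b $ i + t < 1" if "i < n" for i
      using t a01[OF that] b01[OF that] Lambda_reflexive_coordinates[OF E' refl' a that]
        Lambda_reflexive_coordinates[OF E'' refl'' b that] by auto
    have t0: "t \<ge> 0" using t h by auto
    have l01: "0 \<le> l $ i" "l $ i < 1" "0 \<le> l $ (n + i)" "l $ (n + i) < 1" if "i < n" for i
      using a01[OF that] b01[OF that] lt[OF that] t0 by (auto simp: la[OF that] lb[OF that])
    have "0 \<le> l $ i \<and> l $ i < 1" if "i < 2 * n" for i
      using l01[of i] l01[of "i - n"] that by (cases "i < n") auto
    then have "l \<in> unit_cube (2 * n)" using lc by (simp add: unit_cube_def)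
    moreover have "\<forall>j<2 * n. graph_laplace (2 * n) ?B (($) l) j \<in> \<int>"
    proof (rule iffD2[OF graph_laplace_bridge_Ints[OF E' E'' _ _ _ _ n]])
      have "graph_laplace n E' (($) l) j = graph_laplace n E' (\<lambda>i. a $ i + t) j"
        "graph_laplace n E'' (\<lambda>i. l $ (n + i)) j = graph_laplace n E'' (\<lambda>i. b $ i + t) j"
        if "j < n" for j
        by (rule graph_laplace_cong; use that la lb in simp)+
      moreover have "l $ (n - 1) = l $ (n + (n - 1))" using la[OF last] lb[OF last] ab by simp
      ultimately show "(\<forall>j<n. graph_laplace n E' (($) l) j \<in> \<int>) \<and>
          (\<forall>j<n. graph_laplace n E'' (\<lambda>i. l $ (n + i)) j \<in> \<int>) \<and>
          l $ (n - 1) = l $ (n + (n - 1))"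
        using a' b' by (simp add: graph_laplace_shift)
    qed (use l01[OF last] in auto)
    moreover have "(\<Sum>i<2 * n. l $ i) \<in> \<int>"
    proof -
      \<comment> \<open>The shift adds \<open>2 * n * t\<close>, which is 0 or 1, to the
        total.\<close>
      have "(\<Sum>i<2 * n. l $ i) = (\<Sum>i<n. a $ i) + (\<Sum>i<n. b $ i) + 2 * (real n * t)"
        unfolding sum_lessThan_double by (simp add: la lb sum.distrib)
      moreover have "2 * (real n * t) \<in> \<int>" using t h by auto
      ultimately show ?thesis using a' b' by (simp add: Ints_add)
    qed
    ultimately show ?L unfolding mem by blast
  qed
qed

theorem theorem3p30:
  fixes n :: nat and E' E'' B :: "nat set set" and L2n :: "real mat"
  assumes "n \<ge> 1"
    and "simple_graph_on n E'" and "connected_graph_on n E'"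
    and "simple_graph_on n E''" and "connected_graph_on n E''"
    and "reflexive (n - 1) (laplacian_simplex n E')"
    and "reflexive (n - 1) (laplacian_simplex n E'')"
    and "B = bridge_graph n E' E''"
    and "L2n = reduced_laplacian (2 * n) B"
  shows "fund_parallelepiped L2n \<inter> int_vecs (2 * n) =
    {row_mult (l' @\<^sub>v l'') (append_ones L2n) | l' l''.
       l' \<in> Lambda (reduced_laplacian n E') \<and> l'' \<in> Lambda (reduced_laplacian n E'') \<and>
       l' $ (n - 1) = l'' $ (n - 1)} \<union>
    {row_mult ((l' @\<^sub>v l'') + (1 / (2 * real n)) \<cdot>\<^sub>v ones_vec (2 * n)) (append_ones L2n) | l' l''.
       l' \<in> Lambda (reduced_laplacian n E') \<and> l'' \<in> Lambda (reduced_laplacian n E'') \<and>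
       l' $ (n - 1) = l'' $ (n - 1)}"
proof -
  note carrier = reduced_laplacian_carrier[of "2 * n" B]
  have "dim_row L2n = 2 * n" "dim_col L2n + 1 = 2 * n"
    using carrier assms(1,9) by auto
  \<comment> \<open>Lattice points are the images of the coefficient vectors in
    \<open>Lambda L2n\<close>, so it suffices to describe that set.\<close>
  then have "fund_parallelepiped L2n \<inter> int_vecs (2 * n) =
      (\<lambda>l. row_mult l (append_ones L2n)) ` Lambda L2n"
    unfolding fund_parallelepiped_def Lambda_def by auto
  moreover have "l \<in> Lambda L2n \<longleftrightarrow>
      (\<exists>l' l''. l' \<in> Lambda (reduced_laplacian n E') \<and> l'' \<in> Lambda (reduced_laplacian n E'') \<and>
        l' $ (n - 1) = l'' $ (n - 1) \<and>
        (l = l' @\<^sub>v l'' \<or> l = (l' @\<^sub>v l'') + (1 / (2 * real n)) \<cdot>\<^sub>v ones_vec (2 * n)))" for l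
    unfolding assms(8,9) by (rule Lambda_bridge_graph[OF assms(1,2,4,6,7)])
  ultimately show ?thesis
    by (intro equalityI subsetI) (simp only: image_iff Bex_def Un_iff mem_Collect_eq, blast)+
qed

end
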